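(* Let $\mathcal P\subset\mathbb R^d$ be an integral $d$-simplex with vertices $v_0,v_1,\ldots,v_d\in\mathbb Z^d$, and let $S$ be the set of all integer points $(\alpha,n)\in\mathbb Z^{d}\times\mathbb Z$ of the form $(\alpha,n)=\sum_{j=0}^d r_j(v_j,1)$ with $r_j\in\mathbb Q$ and $0\le r_j<1$ for all $j$. Then the following are equivalent: (i) the $\delta$-vector $\delta(\mathcal P)$ is shifted symmetric; (ii) every facet of $\mathcal P$ has normalized volume $1$; (iii) every element $(\alpha,n)\in S\setminus\{(0,\ldots,0,0)\}$ has a (unique) expression of the form $(\alpha,n)=\sum_{j=0}^d r_j(v_j,1)$ with $0<r_j<1$ for all $j=0,1,\ldots,d$.
   Context: For an integral convex polytope $\mathcal P\subset\mathbb R^N$ of dimension $d$, let $i(\mathcal P,n)=|n\mathcal P\cap\mathbb Z^N|$. The $\delta$-vector $\delta(\mathcal P)=(\delta_0,\ldots,\delta_d)$ is defined by $(1-\lambda)^{d+1}\bigl[1+\sum_{n\ge1}i(\mathcal P,n)\lambda^n\bigr]=\sum_{i=0}^d\delta_i\lambda^i$. The normalized volume of $\mathcal P$ is $\sum_{i=0}^d\delta_i$ (for a facet, computed with respect to its own dimension and lattice points). $\delta(\mathcal P)$ is called shifted symmetric if $\delta_{d-i}=\delta_{i+1}$ for every $0\le i\le\lfloor (d-1)/2\rfloor$. *)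

theory Defs
  imports "HOL-Analysis.Analysis" "HOL-Computational_Algebra.Formal_Power_Series"
    "HOL-Library.FuncSet"
begin

definition int_lattice :: "(real ^ 'n) set" where
  "int_lattice = {x. \<forall>k. vec_nth x k \<in> \<int>}"

definition ehrhart :: "(real ^ 'n) set \<Rightarrow> nat \<Rightarrow> nat" where
  "ehrhart P n = card ((\<lambda>x. real n *\<^sub>R x) ` P \<inter> int_lattice)"

definition polytope_dim :: "(real ^ 'n) set \<Rightarrow> nat" where
  "polytope_dim P = nat (aff_dim P)"

text \<open>For an integral polytope of dimension \<open>d\<close> the power series
  \<open>(1 - X)^(d+1) * (1 + (\<Sum>n\<ge>1. ehrhart P n * X^n))\<close> is a polynomial of degree at most \<open>d\<close>;
  the delta-vector consists of its coefficients \<open>0, \<dots>, d\<close>. Here \<open>d\<close> is the dimension of \<open>P\<close>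
  itself, not that of the ambient space, so that the definition also applies to facets.\<close>
definition delta_vector :: "(real ^ 'n) set \<Rightarrow> nat \<Rightarrow> int" where
  "delta_vector P i = fps_nth
     ((1 - fps_X) ^ (polytope_dim P + 1) *
      (1 + Abs_fps (\<lambda>n. if n \<ge> 1 then int (ehrhart P n) else 0))) i"

definition normalized_volume :: "(real ^ 'n) set \<Rightarrow> int" where
  "normalized_volume P = (\<Sum>i = 0..polytope_dim P. delta_vector P i)"

text \<open>Division on \<open>int\<close> rounds down, so there is no condition when \<open>d = 0\<close>.\<close>
definition shifted_symmetric :: "nat \<Rightarrow> (nat \<Rightarrow> int) \<Rightarrow> bool" where
  "shifted_symmetric d \<delta> \<longleftrightarrow>
     (\<forall>i. int i \<le> (int d - 1) div 2 \<longrightarrow> \<delta> (d - i) = \<delta> (i + 1))"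

definition box_points :: "nat \<Rightarrow> (nat \<Rightarrow> real ^ 'n) \<Rightarrow> ((real ^ 'n) \<times> real) set" where
  "box_points d v = {(\<alpha>, n). \<alpha> \<in> int_lattice \<and> n \<in> \<int> \<and>
     (\<exists>r :: nat \<Rightarrow> real. (\<forall>j\<in>{0..d}. r j \<in> \<rat> \<and> 0 \<le> r j \<and> r j < 1) \<and>
        (\<alpha>, n) = (\<Sum>j = 0..d. r j *\<^sub>R (v j, 1)))}"

end

(* The i-th entry of the delta-vector of a simplex is the number of box points of height i (the
   height of a point is the sum of its coefficients), so the normalized volume is the number of box
   points, and the box points of the facet opposite v_k are those whose k-th coefficient vanishes.
   This gives the equivalence of the facet condition with the full support of all nonzero box
   points. The box points form a finite group; a box point r and its inverse have heights adding up
   to the size of the support of r. If all nonzero box points have full support, inversion swaps the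
   heights i and d + 1 - i. Conversely, shifted symmetry says that the average height of the nonzero
   box points is (d + 1) / 2, so the average size of the supports is d + 1, which is the maximum. *)
theory Submission
  imports Defs
begin

section \<open>Integer points and their finiteness in bounded sets\<close>

lemma int_lattice_0: "0 \<in> int_lattice"
  by (simp add: int_lattice_def)

lemma int_lattice_add: "x \<in> int_lattice \<Longrightarrow> y \<in> int_lattice \<Longrightarrow> x + y \<in> int_lattice"
  by (simp add: int_lattice_def)

lemma int_lattice_scaleR: "a \<in> \<int> \<Longrightarrow> x \<in> int_lattice \<Longrightarrow> a *\<^sub>R x \<in> int_lattice"
  by (simp add: int_lattice_def)

lemma int_lattice_sum: "(\<And>j. j \<in> J \<Longrightarrow> f j \<in> int_lattice) \<Longrightarrow> sum f J \<in> int_lattice"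
  by (induction J rule: infinite_finite_induct) (auto simp: int_lattice_0 int_lattice_add)

text \<open>Each coordinate is an integer whose absolute value is at most the bound on the norm,
  which leaves finitely many choices per coordinate.\<close>

lemma finite_bounded_int_lattice:
  fixes A :: "(real ^ 'n) set"
  assumes "bounded A"
  shows "finite (A \<inter> int_lattice)"
proof -
  obtain B where B: "\<And>x. x \<in> A \<Longrightarrow> norm x \<le> B"
    using assms bounded_iff by blast
  let ?Z = "{x::real. x \<in> \<int> \<and> \<bar>x\<bar> \<le> B}"
  have "finite (vec_lambda ` ((UNIV::'n set) \<rightarrow>\<^sub>E ?Z))"
    by (intro finite_imageI finite_PiE) (auto simp: finite_abs_int_segment)
  moreover have "A \<inter> int_lattice \<subseteq> vec_lambda ` ((UNIV::'n set) \<rightarrow>\<^sub>E ?Z)"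
  proof
    fix x assume x: "x \<in> A \<inter> int_lattice"
    have "\<bar>x $ k\<bar> \<le> B" for k
      using x B component_le_norm_cart[of x k] by (meson IntD1 order_trans)
    then have "vec_nth x \<in> (UNIV::'n set) \<rightarrow>\<^sub>E ?Z"
      using x by (auto simp: int_lattice_def)
    then show "x \<in> vec_lambda ` ((UNIV::'n set) \<rightarrow>\<^sub>E ?Z)"
      by (rule image_eqI[rotated]) (simp add: vec_nth_inverse)
  qed
  ultimately show ?thesis
    by (rule finite_subset[rotated])
qed

lemma frac_add_frac_uminus: "frac x + frac (- x) = (if x \<in> \<int> then 0 else (1::real))"
  by (auto simp: frac_neg)

section \<open>Coefficient functions of cone points and box points\<close>

text \<open>\<open>sum c J\<close> is the last coordinate of the combination of the vectors
  \<open>(v j, 1)\<close>. The fixed value 0 off \<open>J\<close> lets single functions stand for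
  points, and coefficients over a face are then coefficients over the whole simplex.\<close>

definition integral_comb :: "('i \<Rightarrow> real ^ 'n) \<Rightarrow> 'i set \<Rightarrow> ('i \<Rightarrow> real) \<Rightarrow> bool" where
  "integral_comb v J c \<longleftrightarrow> (\<forall>j. j \<notin> J \<longrightarrow> c j = 0) \<and> sum c J \<in> \<int> \<and>
     (\<Sum>j\<in>J. c j *\<^sub>R v j) \<in> int_lattice"

definition box_coeffs :: "('i \<Rightarrow> real ^ 'n) \<Rightarrow> 'i set \<Rightarrow> ('i \<Rightarrow> real) set" where
  "box_coeffs v J = {r. integral_comb v J r \<and> (\<forall>j. 0 \<le> r j \<and> r j < 1)}"

text \<open>The lattice points at height \<open>n\<close> of the cone over the simplex; coefficients outside \<open>K\<close> stay
  below 1, so \<open>K = J\<close> gives the points of the \<open>n\<close>-th dilate and \<open>K = {}\<close> the box points.\<close>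
definition cone_coeffs :: "('i \<Rightarrow> real ^ 'n) \<Rightarrow> 'i set \<Rightarrow> 'i set \<Rightarrow> nat \<Rightarrow> ('i \<Rightarrow> real) set" where
  "cone_coeffs v J K n = {c. integral_comb v J c \<and> (\<forall>j. 0 \<le> c j) \<and> (\<forall>j. j \<notin> K \<longrightarrow> c j < 1) \<and>
     sum c J = real n}"

lemma zero_in_box_coeffs: "(\<lambda>_. 0) \<in> box_coeffs v J"
  by (simp add: box_coeffs_def integral_comb_def int_lattice_0)

lemma box_coeffs_Diff_singleton:
  assumes "finite J" "k \<in> J"
  shows "box_coeffs v (J - {k}) = {r \<in> box_coeffs v J. r k = 0}"
proof -
  have "integral_comb v (J - {k}) r \<longleftrightarrow> integral_comb v J r \<and> r k = 0" for r
    using assms by (auto simp: integral_comb_def sum.remove[of J k])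
  then show ?thesis
    by (auto simp: box_coeffs_def)
qed

section \<open>Affine coordinates with respect to a lattice simplex\<close>

text \<open>The index set is arbitrary and the simplex may have any dimension in its space, so that
  facets, obtained by removing one index, are instances as well.\<close>

locale lattice_simplex =
  fixes v :: "'i \<Rightarrow> real ^ 'n" and J :: "'i set"
  assumes finite_J: "finite J"
    and J_nonempty: "J \<noteq> {}"
    and vertex_int: "\<And>j. j \<in> J \<Longrightarrow> v j \<in> int_lattice"
    and inj_v: "inj_on v J"
    and indep: "\<not> affine_dependent (v ` J)"
begin

lemma coeffs_unique:
  assumes "sum c J = sum c' J" "(\<Sum>j\<in>J. c j *\<^sub>R v j) = (\<Sum>j\<in>J. c' j *\<^sub>R v j)" "j \<in> J"
  shows "c j = c' j"
proof (rule ccontr)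
  assume neq: "c j \<noteq> c' j"
  \<comment> \<open>Affine dependence speaks of a set of points, so the difference of the
    coefficients is carried from indices to vertices by inverting \<open>v\<close> on
    \<open>J\<close>.\<close>
  let ?u = "\<lambda>x. c (inv_into J v x) - c' (inv_into J v x)"
  have "sum ?u (v ` J) = 0"
    using assms(1) by (simp add: sum.reindex[OF inj_v] inv_into_f_f[OF inj_v] sum_subtractf cong: sum.cong)
  moreover have "(\<Sum>x\<in>v ` J. ?u x *\<^sub>R x) = 0"
    using assms(2)
    by (simp add: sum.reindex[OF inj_v] inv_into_f_f[OF inj_v] sum_subtractf scaleR_diff_left cong: sum.cong)
  moreover have "\<exists>x\<in>v ` J. ?u x \<noteq> 0"
    using neq assms(3) by (intro bexI[of _ "v j"]) (auto simp: inv_into_f_f[OF inj_v])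
  ultimately have "affine_dependent (v ` J)"
    using finite_J by (subst affine_dependent_explicit_finite) (auto intro!: exI[of _ ?u])
  then show False
    using indep by blast
qed

text \<open>Integer changes of the coefficients add an integer combination of the lattice points
  \<open>(v j, 1)\<close>.\<close>

lemma integral_comb_shift:
  assumes "\<And>j. j \<notin> J \<Longrightarrow> c j = 0" "integral_comb v J b" "\<And>j. j \<in> J \<Longrightarrow> c j - b j \<in> \<int>"
  shows "integral_comb v J c"
proof -
  have "sum c J = sum b J + (\<Sum>j\<in>J. c j - b j)"
    by (simp add: sum_subtractf)
  moreover have "(\<Sum>j\<in>J. c j - b j) \<in> \<int>"
    using assms(3) by (rule Ints_sum)
  moreover have "(\<Sum>j\<in>J. c j *\<^sub>R v j) = (\<Sum>j\<in>J. b j *\<^sub>R v j) + (\<Sum>j\<in>J. (c j - b j) *\<^sub>R v j)"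
    by (simp add: sum_subtractf scaleR_diff_left)
  moreover have "(\<Sum>j\<in>J. (c j - b j) *\<^sub>R v j) \<in> int_lattice"
    using assms(3) vertex_int by (intro int_lattice_sum int_lattice_scaleR)
  ultimately show ?thesis
    using assms(1,2) by (auto simp: integral_comb_def int_lattice_add)
qed

lemma integral_comb_cmult:
  assumes "a \<in> \<int>" "integral_comb v J c"
  shows "integral_comb v J (\<lambda>j. a * c j)"
  using assms int_lattice_scaleR[of a "\<Sum>j\<in>J. c j *\<^sub>R v j"]
  by (auto simp: integral_comb_def scaleR_sum_right simp flip: sum_distrib_left)

text \<open>Taking fractional parts is reduction modulo the lattice spanned by the
  \<open>(v j, 1)\<close>; box points represent the classes of the quotient group.\<close>

lemma frac_in_box_coeffs:
  assumes "integral_comb v J c"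
  shows "(\<lambda>j. frac (c j)) \<in> box_coeffs v J"
proof -
  have "integral_comb v J (\<lambda>j. frac (c j))"
    using assms by (rule integral_comb_shift[rotated]) (use assms in \<open>auto simp: integral_comb_def frac_def\<close>)
  then show ?thesis
    by (simp add: box_coeffs_def frac_lt_1)
qed

section \<open>Lattice points of the dilates\<close>

text \<open>The coefficients of height \<open>n\<close> are the barycentric coordinates multiplied
  by \<open>n\<close>.\<close>

lemma bij_betw_cone_coeffs:
  "bij_betw (\<lambda>c. \<Sum>j\<in>J. c j *\<^sub>R v j) (cone_coeffs v J J n)
     ((\<lambda>x. real n *\<^sub>R x) ` (convex hull (v ` J)) \<inter> int_lattice)"
proof (rule bij_betw_imageI)
  show "inj_on (\<lambda>c. \<Sum>j\<in>J. c j *\<^sub>R v j) (cone_coeffs v J J n)"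
  proof (rule inj_onI)
    fix c c' assume "c \<in> cone_coeffs v J J n" "c' \<in> cone_coeffs v J J n"
      and "(\<Sum>j\<in>J. c j *\<^sub>R v j) = (\<Sum>j\<in>J. c' j *\<^sub>R v j)"
    then have "c j = c' j" for j
      using coeffs_unique[of c c' j]
      by (cases "j \<in> J") (auto simp: cone_coeffs_def integral_comb_def)
    then show "c = c'" by blast
  qed
  have hull: "convex hull (v ` J) = {\<Sum>j\<in>J. u j *\<^sub>R v j |u. (\<forall>j\<in>J. 0 \<le> u j) \<and> sum u J = 1}"
  proof (intro set_eqI iffI)
    fix x assume "x \<in> convex hull (v ` J)"
    then obtain u where u: "\<forall>x\<in>v ` J. 0 \<le> u x" "sum u (v ` J) = 1" "(\<Sum>x\<in>v ` J. u x *\<^sub>R x) = x"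
      using finite_J by (auto simp: convex_hull_finite)
    then show "x \<in> {\<Sum>j\<in>J. u j *\<^sub>R v j |u. (\<forall>j\<in>J. 0 \<le> u j) \<and> sum u J = 1}"
      by (auto intro!: exI[of _ "u \<circ> v"] simp: sum.reindex[OF inj_v] o_def)
  next
    fix x assume "x \<in> {\<Sum>j\<in>J. u j *\<^sub>R v j |u. (\<forall>j\<in>J. 0 \<le> u j) \<and> sum u J = 1}"
    then obtain u where "x = (\<Sum>j\<in>J. u j *\<^sub>R v j)" "\<forall>j\<in>J. 0 \<le> u j" "sum u J = 1"
      by blast
    then show "x \<in> convex hull (v ` J)"
      using finite_J by (simp only:) (rule convex_sum, auto intro: hull_inc)
  qed
  show "(\<lambda>c. \<Sum>j\<in>J. c j *\<^sub>R v j) ` cone_coeffs v J J n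
      = (\<lambda>x. real n *\<^sub>R x) ` (convex hull (v ` J)) \<inter> int_lattice" (is "?L = ?R")
  proof (intro set_eqI iffI)
    fix x assume "x \<in> ?L"
    then obtain c where c: "c \<in> cone_coeffs v J J n" and x: "x = (\<Sum>j\<in>J. c j *\<^sub>R v j)"
      by blast
    have "x \<in> (\<lambda>x. real n *\<^sub>R x) ` (convex hull (v ` J))"
    \<comment> \<open>For \<open>n = 0\<close> there is no dividing by \<open>n\<close>; the dilate
      is then the single point 0, because the simplex is nonempty.\<close>
    proof (cases "n = 0")
      case True
      then have "\<forall>j\<in>J. c j = 0"
        using c finite_J by (auto simp: cone_coeffs_def sum_nonneg_eq_0_iff)
      then show ?thesis
        using x True J_nonempty by (auto simp: image_constant_conv)
    next
      case False
      let ?y = "\<Sum>j\<in>J. (c j / real n) *\<^sub>R v j"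
      have "x = real n *\<^sub>R ?y"
        using False by (simp add: x scaleR_sum_right)
      moreover have "?y \<in> convex hull (v ` J)"
        unfolding hull using c False
        by (auto intro!: exI[of _ "\<lambda>j. c j / real n"] simp: cone_coeffs_def simp flip: sum_divide_distrib)
      ultimately show ?thesis by blast
    qed
    then show "x \<in> ?R"
      using c x by (auto simp: cone_coeffs_def integral_comb_def)
  next
    fix x assume x: "x \<in> ?R"
    then obtain u where u: "\<forall>j\<in>J. 0 \<le> u j" "sum u J = 1"
      and xu: "x = real n *\<^sub>R (\<Sum>j\<in>J. u j *\<^sub>R v j)"
      by (auto simp: hull)
    let ?c = "\<lambda>j. if j \<in> J then real n * u j else 0"
    have "x = (\<Sum>j\<in>J. ?c j *\<^sub>R v j)"
      by (simp add: xu scaleR_sum_right cong: sum.cong)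
    moreover have "?c \<in> cone_coeffs v J J n"
    proof -
      have "sum ?c J = real n"
        using u by (simp flip: sum_distrib_left cong: sum.cong)
      then show ?thesis
        using calculation x u(1) by (auto simp: cone_coeffs_def integral_comb_def)
    qed
    ultimately show "x \<in> ?L" by (rule image_eqI)
  qed
qed

lemma finite_cone_coeffs:
  assumes "K \<subseteq> J"
  shows "finite (cone_coeffs v J K n)"
proof -
  have "bounded ((\<lambda>x. real n *\<^sub>R x) ` (convex hull (v ` J)))"
    using finite_J by (intro bounded_scaling bounded_convex_hull finite_imp_bounded) auto
  then have "finite (cone_coeffs v J J n)"
    using bij_betw_finite[OF bij_betw_cone_coeffs] finite_bounded_int_lattice by blast
  moreover have "cone_coeffs v J K n \<subseteq> cone_coeffs v J J n"
    using assms by (auto simp: cone_coeffs_def integral_comb_def)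
  ultimately show ?thesis
    by (rule finite_subset[rotated])
qed

lemma ehrhart_eq_card_cone_coeffs:
  "ehrhart (convex hull (v ` J)) n = card (cone_coeffs v J J n)"
  unfolding ehrhart_def using bij_betw_same_card[OF bij_betw_cone_coeffs] by simp

section \<open>Generating functions of the cone points\<close>

text \<open>For \<open>K = J\<close> this is the Ehrhart series, for \<open>K = {}\<close> the
  generating polynomial of the box points by height.\<close>

definition cone_series :: "'i set \<Rightarrow> int fps" where
  "cone_series K = Abs_fps (\<lambda>n. int (card (cone_coeffs v J K n)))"

lemma cone_coeffs_0: "cone_coeffs v J K 0 = {\<lambda>_. 0}"
proof (intro set_eqI iffI)
  fix c assume "c \<in> cone_coeffs v J K 0"
  then have "c j = 0" for j
    using finite_J
    by (cases "j \<in> J") (auto simp: cone_coeffs_def integral_comb_def sum_nonneg_eq_0_iff)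
  then show "c \<in> {\<lambda>_. 0}" by auto
qed (auto simp: cone_coeffs_def integral_comb_def int_lattice_0)

text \<open>A coefficient that is unbounded either is already below 1 or can be lowered by 1; on generating
  functions, releasing the bound on one coefficient thus amounts to dividing by \<open>1 - X\<close>.\<close>
lemma cone_coeffs_insert_Suc:
  assumes "k \<in> J"
  shows "cone_coeffs v J (insert k K) (Suc n) =
    cone_coeffs v J K (Suc n) \<union> (\<lambda>c. c(k := c k + 1)) ` cone_coeffs v J (insert k K) n"
    (is "?A = ?B \<union> ?f ` ?C")
proof (intro set_eqI iffI)
  have sum_upd: "sum (c(k := x)) J = sum c J - c k + x" for c :: "'i \<Rightarrow> real" and x
    using assms finite_J by (simp add: sum.remove[of J k])
  fix c
  { assume c: "c \<in> ?A"
    show "c \<in> ?B \<union> ?f ` ?C"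
    proof (cases "c k < 1")
      case True
      then show ?thesis using c by (auto simp: cone_coeffs_def)
    next
      case False
      let ?c = "c(k := c k - 1)"
      have "integral_comb v J ?c"
        by (rule integral_comb_shift[of _ c])
          (use c assms in \<open>auto simp: cone_coeffs_def integral_comb_def\<close>)
      then have "?c \<in> ?C"
        using c False sum_upd[of c] by (auto simp: cone_coeffs_def simp del: fun_upd_apply) auto
      then show ?thesis
        by (intro UnI2 image_eqI[of _ _ ?c]) auto
    qed
  }
  assume "c \<in> ?B \<union> ?f ` ?C"
  then consider "c \<in> ?B" | b where "b \<in> ?C" "c = ?f b"
    by blast
  then show "c \<in> ?A"
  proof cases
    case 1
    then show ?thesis by (auto simp: cone_coeffs_def)
  next
    case 2
    have "integral_comb v J c"
      by (rule integral_comb_shift[of _ b])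
        (use 2 assms in \<open>auto simp: cone_coeffs_def integral_comb_def\<close>)
    then show ?thesis
      using 2 sum_upd[of b] by (auto simp: cone_coeffs_def simp del: fun_upd_apply) auto
  qed
qed

text \<open>In degree \<open>Suc m\<close>, the points at that height split into those still bounded
  at \<open>k\<close> and a bijective copy of the points at height \<open>m\<close>.\<close>

lemma cone_series_insert:
  assumes "k \<in> J" "k \<notin> K" "K \<subseteq> J"
  shows "(1 - fps_X) * cone_series (insert k K) = cone_series K"
proof (rule fps_ext)
  fix n
  let ?f = "\<lambda>c :: 'i \<Rightarrow> real. c(k := c k + 1)"
  show "fps_nth ((1 - fps_X) * cone_series (insert k K)) n = fps_nth (cone_series K) n"
  proof (cases n)
    case 0
    then show ?thesis
      by (simp add: cone_series_def cone_coeffs_0)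
  next
    case (Suc m)
    have "inj ?f"
      by (rule injI) (metis fun_upd_eqD fun_upd_triv fun_upd_upd add_right_cancel)
    then have "card (?f ` cone_coeffs v J (insert k K) m) = card (cone_coeffs v J (insert k K) m)"
      by (meson card_image inj_on_subset subset_UNIV)
    \<comment> \<open>The \<open>k\<close>-th coefficient is below 1 in the first set and at least 1
      in the second.\<close>
    moreover have "cone_coeffs v J K n \<inter> ?f ` cone_coeffs v J (insert k K) m = {}"
    proof -
      have "c k < 1" if "c \<in> cone_coeffs v J K n" for c
        using that assms(2) by (simp add: cone_coeffs_def)
      moreover have "0 \<le> c k" if "c \<in> cone_coeffs v J (insert k K) m" for c
        using that by (simp add: cone_coeffs_def)
      ultimately show ?thesis
        by (force simp: not_less)
    qed
    ultimately have "card (cone_coeffs v J (insert k K) n)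
        = card (cone_coeffs v J K n) + card (cone_coeffs v J (insert k K) m)"
      using assms unfolding Suc cone_coeffs_insert_Suc[OF assms(1)]
      by (subst card_Un_disjoint) (auto intro!: finite_cone_coeffs)
    then show ?thesis
      using Suc by (simp add: cone_series_def left_diff_distrib)
  qed
qed

lemma cone_series_power:
  assumes "K \<subseteq> J"
  shows "(1 - fps_X) ^ card K * cone_series K = cone_series {}"
proof -
  have "finite K"
    using assms finite_J finite_subset by blast
  then show ?thesis
    using assms
  proof (induction K)
    case (insert k K)
    then have "(1 - fps_X) ^ card (insert k K) * cone_series (insert k K)
        = (1 - fps_X) ^ card K * ((1 - fps_X) * cone_series (insert k K))"
      by (simp add: mult_ac)
    also have "\<dots> = cone_series {}"
      using insert by (simp add: cone_series_insert)
    finally show ?case .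
  qed simp
qed

section \<open>The delta-vector and the normalized volume in terms of box points\<close>

lemma polytope_dim_simplex: "polytope_dim (convex hull (v ` J)) + 1 = card J"
proof -
  have "card J > 0"
    using finite_J J_nonempty card_gt_0_iff by blast
  moreover have "aff_dim (v ` J) = int (card J) - 1"
    using aff_dim_affine_independent[OF indep] card_image[OF inj_v] by simp
  ultimately show ?thesis
    by (simp add: polytope_dim_def aff_dim_convex_hull)
qed

lemma delta_vector_simplex:
  "delta_vector (convex hull (v ` J)) n = int (card (cone_coeffs v J {} n))"
proof -
  \<comment> \<open>In degree 0 the separate summand 1 counts the only cone point of height
    0.\<close>
  have "1 + Abs_fps (\<lambda>n. if n \<ge> 1 then int (ehrhart (convex hull (v ` J)) n) else 0)
      = cone_series J"
    by (intro fps_ext) (auto simp: cone_series_def ehrhart_eq_card_cone_coeffs cone_coeffs_0 not_le)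
  then have "delta_vector (convex hull (v ` J)) n = fps_nth (cone_series {}) n"
    using cone_series_power[of J] by (simp only: delta_vector_def polytope_dim_simplex subset_refl)
  then show ?thesis
    by (simp add: cone_series_def)
qed

lemma box_coeffs_sum_less:
  assumes "r \<in> box_coeffs v J"
  shows "sum r J < real (card J)"
proof -
  have "sum r J < (\<Sum>j\<in>J. 1)"
    using assms finite_J J_nonempty by (intro sum_strict_mono) (auto simp: box_coeffs_def)
  then show ?thesis by simp
qed

text \<open>Heights are nonnegative integers, and less than \<open>card J\<close> because every
  coefficient is below 1.\<close>

lemma box_coeffs_eq_UN: "box_coeffs v J = (\<Union>n\<in>{0..<card J}. cone_coeffs v J {} n)"
proof (intro set_eqI iffI)
  fix r assume r: "r \<in> box_coeffs v J"
  then have "sum r J \<in> \<int>" "0 \<le> sum r J"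
    by (auto simp: box_coeffs_def integral_comb_def intro: sum_nonneg)
  then obtain n where n: "sum r J = real n"
    by (metis Ints_cases of_int_of_nat_eq of_int_0_le_iff zero_le_imp_eq_int)
  then have "n < card J"
    using box_coeffs_sum_less[OF r] by simp
  then show "r \<in> (\<Union>n\<in>{0..<card J}. cone_coeffs v J {} n)"
    using r n by (auto simp: box_coeffs_def cone_coeffs_def)
qed (auto simp: box_coeffs_def cone_coeffs_def)

lemma finite_box_coeffs: "finite (box_coeffs v J)"
  by (simp add: box_coeffs_eq_UN finite_cone_coeffs)

text \<open>Grouping by height turns the entries of the delta-vector into multiplicities. It serves
  for counting box points and for adding up their heights.\<close>

lemma sum_box_coeffs:
  fixes f :: "nat \<Rightarrow> real" and g :: "('i \<Rightarrow> real) \<Rightarrow> real"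
  assumes "\<And>r n. r \<in> box_coeffs v J \<Longrightarrow> sum r J = real n \<Longrightarrow> g r = f n"
  shows "sum g (box_coeffs v J) =
    (\<Sum>n\<in>{0..<card J}. f n * of_int (delta_vector (convex hull (v ` J)) n))"
proof -
  have "sum g (box_coeffs v J) = (\<Sum>n\<in>{0..<card J}. sum g (cone_coeffs v J {} n))"
    unfolding box_coeffs_eq_UN
    by (rule sum.UNION_disjoint) (auto simp: finite_cone_coeffs, auto simp: cone_coeffs_def)
  also have "\<dots> = (\<Sum>n\<in>{0..<card J}. \<Sum>r\<in>cone_coeffs v J {} n. f n)"
    by (intro sum.cong refl assms) (auto simp: cone_coeffs_def box_coeffs_def)
  finally show ?thesis
    by (simp add: delta_vector_simplex mult.commute)
qed

lemma normalized_volume_simplex: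
  "normalized_volume (convex hull (v ` J)) = int (card (box_coeffs v J))"
proof -
  have "{0..polytope_dim (convex hull (v ` J))} = {0..<card J}"
    using polytope_dim_simplex by auto
  moreover have "real (card (box_coeffs v J)) =
      real_of_int (\<Sum>n\<in>{0..<card J}. delta_vector (convex hull (v ` J)) n)"
    using sum_box_coeffs[of "\<lambda>_. 1" "\<lambda>_. 1"] by simp
  ultimately have "real_of_int (normalized_volume (convex hull (v ` J))) =
      real_of_int (int (card (box_coeffs v J)))"
    unfolding normalized_volume_def by simp
  then show ?thesis
    by (simp only: of_int_eq_iff)
qed

text \<open>Pigeonhole: the fractional parts of the multiples of \<open>r\<close> lie in the finite set of box
  coefficients, so two of them coincide.\<close>
lemma box_coeffs_Rats:
  assumes "r \<in> box_coeffs v J"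
  shows "r j \<in> \<rat>"
proof -
  let ?f = "\<lambda>k::nat. \<lambda>j. frac (real k * r j)"
  have "range ?f \<subseteq> box_coeffs v J"
    using assms by (intro image_subsetI frac_in_box_coeffs integral_comb_cmult)
      (auto simp: box_coeffs_def)
  then have "\<not> inj ?f"
    using finite_box_coeffs finite_subset range_inj_infinite by blast
  then obtain k l where kl: "k \<noteq> l" "?f k = ?f l"
    unfolding inj_def by blast
  define m where "m = \<lfloor>real l * r j\<rfloor> - \<lfloor>real k * r j\<rfloor>"
  have "(real l - real k) * r j = of_int m"
    using fun_cong[OF kl(2), of j] by (simp add: m_def frac_def algebra_simps)
  then have "r j = of_int m / (real l - real k)"
    using kl(1) by (simp add: nonzero_eq_divide_eq mult.commute)
  then show ?thesis by simp
qed

section \<open>Inversion in the group of box points\<close>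

lemma neg_box_coeffs:
  "bij_betw (\<lambda>r j. frac (- r j)) (box_coeffs v J) (box_coeffs v J)"
proof -
  let ?neg = "\<lambda>r :: 'i \<Rightarrow> real. \<lambda>j. frac (- r j)"
  have "frac (- frac (- x)) = x" if "0 \<le> x" "x < 1" for x :: real
    using that frac_neg_frac[of "- x"] by (simp add: frac_eq)
  then have "\<forall>r\<in>box_coeffs v J. ?neg (?neg r) = r"
    by (auto simp: box_coeffs_def)
  moreover have "?neg r \<in> box_coeffs v J" if "r \<in> box_coeffs v J" for r
    using that integral_comb_cmult[of "-1" r]
    by (intro frac_in_box_coeffs) (simp add: box_coeffs_def)
  ultimately show ?thesis
    by (intro bij_betw_byWitness[where f' = ?neg]) blast+
qed

text \<open>A coefficient in \<open>[0, 1)\<close> and its inverse add up to 1, unless both are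
  0.\<close>

lemma sum_add_sum_neg:
  assumes "r \<in> box_coeffs v J"
  shows "sum r J + (\<Sum>j\<in>J. frac (- r j)) = real (card {j \<in> J. r j \<noteq> 0})"
proof -
  have "r j + frac (- r j) = (if r j \<noteq> 0 then 1 else 0)" for j
  proof -
    have "frac (r j) = r j" "r j \<in> \<int> \<longleftrightarrow> r j = 0"
      using assms by (auto simp: box_coeffs_def frac_eq frac_eq_0_iff[symmetric] simp del: frac_eq_0_iff)
    then show ?thesis
      using frac_add_frac_uminus[of "r j"] by simp
  qed
  then have "sum r J + (\<Sum>j\<in>J. frac (- r j)) = (\<Sum>j\<in>J. if r j \<noteq> 0 then 1 else 0)"
    by (simp flip: sum.distrib)
  also have "\<dots> = real (card {j \<in> J. r j \<noteq> 0})"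
    using finite_J by (simp add: sum.If_cases Int_def)
  finally show ?thesis .
qed

text \<open>Inversion permutes the box points, so the inverses have the same total height.\<close>

lemma two_sum_heights:
  "2 * (\<Sum>r\<in>box_coeffs v J. sum r J) = (\<Sum>r\<in>box_coeffs v J. real (card {j \<in> J. r j \<noteq> 0}))"
proof -
  have "(\<Sum>r\<in>box_coeffs v J. sum r J) = (\<Sum>r\<in>box_coeffs v J. \<Sum>j\<in>J. frac (- r j))"
    by (rule sum.reindex_bij_betw[OF neg_box_coeffs, symmetric])
  then have "2 * (\<Sum>r\<in>box_coeffs v J. sum r J)
      = (\<Sum>r\<in>box_coeffs v J. sum r J + (\<Sum>j\<in>J. frac (- r j)))"
    by (simp add: sum.distrib)
  also have "\<dots> = (\<Sum>r\<in>box_coeffs v J. real (card {j \<in> J. r j \<noteq> 0}))"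
    by (intro sum.cong refl sum_add_sum_neg)
  finally show ?thesis .
qed

section \<open>Shifted symmetry and full support\<close>

lemma delta_vector_0: "delta_vector (convex hull (v ` J)) 0 = 1"
  by (simp add: delta_vector_simplex cone_coeffs_0)

lemma cone_coeffs_empty: "cone_coeffs v J {} n = {r \<in> box_coeffs v J. sum r J = real n}"
  by (auto simp: box_coeffs_def cone_coeffs_def)

lemma shifted_symmetricI:
  assumes full: "\<And>r k. r \<in> box_coeffs v J \<Longrightarrow> k \<in> J \<Longrightarrow> r k = 0 \<Longrightarrow> r = (\<lambda>_. 0)"
  shows "shifted_symmetric (card J - 1) (delta_vector (convex hull (v ` J)))"
proof -
  let ?neg = "\<lambda>r :: 'i \<Rightarrow> real. \<lambda>j. frac (- r j)"
  \<comment> \<open>An inequality is enough: used for both \<open>n\<close> and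
    \<open>card J - n\<close>, it gives equality.\<close>
  have le: "card (cone_coeffs v J {} n) \<le> card (cone_coeffs v J {} (card J - n))"
    if n: "0 < n" "n < card J" for n
  proof (rule card_inj_on_le)
    show "inj_on ?neg (cone_coeffs v J {} n)"
      using neg_box_coeffs by (rule inj_on_subset[OF bij_betw_imp_inj_on]) (auto simp: cone_coeffs_empty)
    show "?neg ` cone_coeffs v J {} n \<subseteq> cone_coeffs v J {} (card J - n)"
    proof (rule image_subsetI)
      fix r assume r: "r \<in> cone_coeffs v J {} n"
      then have rbox: "r \<in> box_coeffs v J" and sum: "sum r J = real n"
        by (auto simp: cone_coeffs_empty)
      then have "r \<noteq> (\<lambda>_. 0)"
        using n by auto
      then have "{j \<in> J. r j \<noteq> 0} = J"
        using full rbox by blast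
      then have "sum (?neg r) J = real (card J - n)"
        using sum_add_sum_neg[OF rbox] sum n by (simp add: of_nat_diff)
      then show "?neg r \<in> cone_coeffs v J {} (card J - n)"
        using bij_betw_apply[OF neg_box_coeffs rbox] by (simp add: cone_coeffs_empty)
    qed
  qed (simp add: finite_cone_coeffs)
  have sym: "delta_vector (convex hull (v ` J)) n = delta_vector (convex hull (v ` J)) (card J - n)"
    if "0 < n" "n < card J" for n
    using le[of n] le[of "card J - n"] that by (simp add: delta_vector_simplex)
  show ?thesis
    unfolding shifted_symmetric_def
  proof (intro allI impI)
    fix i assume "int i \<le> (int (card J - 1) - 1) div 2"
    then have "Suc i < card J"
      by linarith
    then show "delta_vector (convex hull (v ` J)) (card J - 1 - i)
        = delta_vector (convex hull (v ` J)) (i + 1)"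
      using sym[of "Suc i"] by simp
  qed
qed

lemma shifted_symmetricD:
  assumes "shifted_symmetric (card J - 1) (delta_vector (convex hull (v ` J)))"
    and r: "r \<in> box_coeffs v J" and k: "k \<in> J" "r k = 0"
  shows "r = (\<lambda>_. 0)"
proof (rule ccontr)
  assume "r \<noteq> (\<lambda>_. 0)"
  let ?\<delta> = "delta_vector (convex hull (v ` J))" and ?C = "card J" and ?G = "box_coeffs v J"
  let ?supp = "\<lambda>r. real (card {j \<in> J. r j \<noteq> (0::real)})"
  have C: "?C > 0"
    using finite_J J_nonempty card_gt_0_iff by blast
  \<comment> \<open>The definition of shifted symmetry covers only about half of the indices; for
    the others \<open>n\<close> and \<open>?C - n\<close> trade places.\<close>
  have sym: "?\<delta> (?C - n) = ?\<delta> n" if n: "0 < n" "n < ?C" for n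
  proof (cases "int (n - 1) \<le> (int (?C - 1) - 1) div 2")
    case True
    then have "?\<delta> (?C - 1 - (n - 1)) = ?\<delta> (n - 1 + 1)"
      using assms(1) unfolding shifted_symmetric_def by blast
    then show ?thesis
      using n by simp
  next
    case False
    then have "int (?C - 1 - n) \<le> (int (?C - 1) - 1) div 2"
      using n by linarith
    then have "?\<delta> (?C - 1 - (?C - 1 - n)) = ?\<delta> (?C - 1 - n + 1)"
      using assms(1) unfolding shifted_symmetric_def by blast
    then show ?thesis
      using n by (simp add: Suc_diff_Suc)
  qed
  have split: "{0..<?C} = insert 0 {1..<?C}"
    using C by auto
  \<comment> \<open>Averaging the sum with its reflection replaces the weight \<open>n\<close> by
    \<open>?C / 2\<close>. Index 0, which belongs to the zero box point, stays out of the
    reflection.\<close>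
  have "(\<Sum>n\<in>{1..<?C}. real n * ?\<delta> n) = (\<Sum>n\<in>{1..<?C}. real (?C - n) * ?\<delta> n)"
    by (rule sum.reindex_bij_witness[of _ "\<lambda>n. ?C - n" "\<lambda>n. ?C - n"]) (auto simp: sym)
  then have "2 * (\<Sum>n\<in>{1..<?C}. real n * ?\<delta> n)
      = (\<Sum>n\<in>{1..<?C}. real n * ?\<delta> n + real (?C - n) * ?\<delta> n)"
    by (simp add: sum.distrib)
  also have "\<dots> = (\<Sum>n\<in>{1..<?C}. real ?C * ?\<delta> n)"
    by (intro sum.cong refl) (simp add: of_nat_diff algebra_simps)
  finally have "2 * (\<Sum>n\<in>{1..<?C}. real n * ?\<delta> n) = real ?C * (\<Sum>n\<in>{1..<?C}. ?\<delta> n)"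
    by (simp add: sum_distrib_left)
  moreover have "real (card ?G) = 1 + real_of_int (\<Sum>n\<in>{1..<?C}. ?\<delta> n)"
    using sum_box_coeffs[of "\<lambda>_. 1" "\<lambda>_. 1"] unfolding split by (simp add: delta_vector_0)
  moreover have "(\<Sum>r\<in>?G. sum r J) = (\<Sum>n\<in>{1..<?C}. real n * ?\<delta> n)"
    using sum_box_coeffs[of "\<lambda>r. sum r J" real] unfolding split by simp
  \<comment> \<open>Twice the total height is both the total size of the supports and
    \<open>?C\<close> times the number of nonzero box points.\<close>
  ultimately have "(\<Sum>r\<in>?G. ?supp r) = real ?C * (real (card ?G) - 1)"
    by (simp flip: two_sum_heights)
  moreover have "(\<Sum>r\<in>?G. ?supp r) = (\<Sum>r\<in>?G - {\<lambda>_. 0}. ?supp r)"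
    using finite_box_coeffs by (simp add: sum.remove[OF _ zero_in_box_coeffs])
  moreover have "real (card (?G - {\<lambda>_. 0})) = real (card ?G) - 1"
    using card.remove[OF finite_box_coeffs zero_in_box_coeffs] by simp
  \<comment> \<open>The numbers of vanishing coefficients are nonnegative and add up to 0, so each
    of them is 0.\<close>
  ultimately have "(\<Sum>r\<in>?G - {\<lambda>_. 0}. real ?C - ?supp r) = 0"
    by (simp only: sum_subtractf sum_constant) simp
  moreover have "0 \<le> real ?C - ?supp s" for s
    using card_mono[OF finite_J, of "{j \<in> J. s j \<noteq> 0}"] by simp
  ultimately have "real ?C - ?supp r = 0"
    using r \<open>r \<noteq> (\<lambda>_. 0)\<close> finite_box_coeffs by (simp add: sum_nonneg_eq_0_iff)
  then have "card {j \<in> J. r j \<noteq> 0} = card J"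
    by simp
  then have "{j \<in> J. r j \<noteq> 0} = J"
    by (intro card_subset_eq[OF finite_J]) auto
  then have "k \<in> {j \<in> J. r j \<noteq> 0}"
    using k(1) by (simp only:)
  then show False
    using k(2) by simp
qed

section \<open>Normalized volumes of the facets\<close>

text \<open>The zero function is always among the box points of a facet, so volume 1 means that it
  is the only one. With two vertices or more, \<open>J - {k}\<close> is nonempty and again spans a
  lattice simplex.\<close>

lemma facet_volumes_iff:
  assumes "2 \<le> card J"
  shows "(\<forall>F. F facet_of convex hull (v ` J) \<longrightarrow> normalized_volume F = 1) \<longleftrightarrow>
    (\<forall>r\<in>box_coeffs v J. (\<exists>k\<in>J. r k = 0) \<longrightarrow> r = (\<lambda>_. 0))"
proof -
  have vol: "normalized_volume (convex hull (v ` (J - {k}))) = 1 \<longleftrightarrow>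
      (\<forall>r\<in>box_coeffs v J. r k = 0 \<longrightarrow> r = (\<lambda>_. 0))" if "k \<in> J" for k
  proof -
    interpret facet: lattice_simplex v "J - {k}"
    proof
      show "J - {k} \<noteq> {}"
        using assms card_Diff_singleton[OF that] by fastforce
      show "\<not> affine_dependent (v ` (J - {k}))"
        using indep by (rule affine_independent_subset) auto
    qed (use finite_J vertex_int inj_v in \<open>auto intro: inj_on_subset\<close>)
    have "normalized_volume (convex hull (v ` (J - {k}))) = 1 \<longleftrightarrow>
        is_singleton (box_coeffs v (J - {k}))"
      by (simp add: facet.normalized_volume_simplex is_singleton_altdef)
    also have "\<dots> \<longleftrightarrow> box_coeffs v (J - {k}) = {\<lambda>_. 0}"
      using zero_in_box_coeffs[of v "J - {k}"] by (auto simp: is_singleton_def)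
    also have "\<dots> \<longleftrightarrow> (\<forall>r\<in>box_coeffs v J. r k = 0 \<longrightarrow> r = (\<lambda>_. 0))"
      using zero_in_box_coeffs[of v J]
      unfolding box_coeffs_Diff_singleton[OF finite_J that] by auto
    finally show ?thesis .
  qed
  have facets: "F facet_of convex hull (v ` J) \<longleftrightarrow> (\<exists>k\<in>J. F = convex hull (v ` (J - {k})))" for F
  proof -
    have "v ` J - {v k} = v ` (J - {k})" if "k \<in> J" for k
      using inj_on_image_set_diff[OF inj_v, of J "{k}"] that by simp
    then show ?thesis
      using assms unfolding facet_of_convex_hull_affine_independent_alt[OF indep] card_image[OF inj_v]
      by auto
  qed
  have "(\<forall>F. F facet_of convex hull (v ` J) \<longrightarrow> normalized_volume F = 1) \<longleftrightarrow>
      (\<forall>k\<in>J. normalized_volume (convex hull (v ` (J - {k}))) = 1)"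
    unfolding facets by auto
  also have "\<dots> \<longleftrightarrow> (\<forall>k\<in>J. \<forall>r\<in>box_coeffs v J. r k = 0 \<longrightarrow> r = (\<lambda>_. 0))"
    using vol by (rule ball_cong[OF refl])
  also have "\<dots> \<longleftrightarrow> (\<forall>r\<in>box_coeffs v J. (\<exists>k\<in>J. r k = 0) \<longrightarrow> r = (\<lambda>_. 0))"
    by blast
  finally show ?thesis .
qed

end

section \<open>From coefficient functions to box points\<close>

lemma box_points_iff:
  assumes int: "\<And>j. j \<le> d \<Longrightarrow> v j \<in> int_lattice"
    and inj: "inj_on v {0..d}" and indep: "\<not> affine_dependent (v ` {0..d})"
  shows "(\<forall>x\<in>box_points d v - {0}.
      \<exists>!r. r \<in> {0..d} \<rightarrow>\<^sub>E {0<..<1} \<and> x = (\<Sum>j = 0..d. r j *\<^sub>R (v j, 1))) \<longleftrightarrow>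
    (\<forall>r\<in>box_coeffs v {0..d}. (\<exists>k\<in>{0..d}. r k = 0) \<longrightarrow> r = (\<lambda>_. 0))"
    (is "?L \<longleftrightarrow> ?R")
proof -
  interpret lattice_simplex v "{0..d}"
    using assms by unfold_locales auto
  let ?comb = "\<lambda>r :: nat \<Rightarrow> real. \<Sum>j = 0..d. r j *\<^sub>R (v j, 1::real)"
  \<comment> \<open>The last coordinate is the sum of the coefficients, so equality of pairs yields
    both premises of \<open>coeffs_unique\<close>.\<close>
  have comb: "?comb r = (\<Sum>j = 0..d. r j *\<^sub>R v j, sum r {0..d})" for r
    by (simp add: prod_eq_iff fst_sum snd_sum)
  have unique: "r j = s j" if "?comb r = ?comb s" "j \<in> {0..d}" for r s j
    using that coeffs_unique[of r s j] by (simp only: comb prod.inject)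
  show ?thesis
  proof
    assume L: ?L
    show ?R
    proof (intro ballI impI)
      fix r assume r: "r \<in> box_coeffs v {0..d}" and "\<exists>k\<in>{0..d}. r k = 0"
      then obtain k where k: "k \<in> {0..d}" "r k = 0" by blast
      \<comment> \<open>\<open>box_points\<close> asks for rational coefficients, which
        \<open>box_coeffs_Rats\<close> supplies.\<close>
      have "?comb r \<in> box_points d v"
        using r box_coeffs_Rats[OF r] unfolding box_points_def comb
        by (auto simp: box_coeffs_def integral_comb_def intro!: exI[of _ r])
      moreover have "\<not> (\<exists>s. s \<in> {0..d} \<rightarrow>\<^sub>E {0<..<1} \<and> ?comb r = ?comb s)"
      proof
        assume "\<exists>s. s \<in> {0..d} \<rightarrow>\<^sub>E {0<..<1} \<and> ?comb r = ?comb s"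
        then obtain s where s: "s \<in> {0..d} \<rightarrow>\<^sub>E {0<..<1}" "?comb r = ?comb s"
          by blast
        have "s k \<in> {0<..<1}"
          using s(1) k(1) by (rule PiE_mem)
        then show False
          using unique[OF s(2) k(1)] k(2) by simp
      qed
      ultimately have "?comb r = 0"
        using L by blast
      also have "0 = ?comb (\<lambda>_. 0)"
        by (simp only: comb) (simp add: zero_prod_def)
      finally have "?comb r = ?comb (\<lambda>_. 0)" .
      then have "r j = 0" for j
        using unique[of r "\<lambda>_. 0" j] r
        by (cases "j \<in> {0..d}") (auto simp: box_coeffs_def integral_comb_def)
      then show "r = (\<lambda>_. 0)" by blast
    qed
  next
    assume R: ?R
    show ?L
    proof
      fix x assume x: "x \<in> box_points d v - {0}"
      then obtain \<alpha> n r where \<alpha>n: "x = (\<alpha>, n)" "\<alpha> \<in> int_lattice" "n \<in> \<int>"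
        and r: "\<forall>j\<in>{0..d}. 0 \<le> r j \<and> r j < 1" and xr: "x = ?comb r"
        unfolding box_points_def by blast
      \<comment> \<open>Coefficient functions in \<open>box_coeffs\<close> are 0 outside the index
        set; those in the unique-existence claim are \<open>undefined\<close> there, hence
        \<open>restrict\<close> below.\<close>
      define s where "s = (\<lambda>j. if j \<in> {0..d} then r j else 0)"
      have xs: "x = ?comb s"
        unfolding xr s_def by (intro sum.cong) auto
      then have "\<alpha> = (\<Sum>j = 0..d. s j *\<^sub>R v j)" "n = sum s {0..d}"
        unfolding comb \<alpha>n(1) by simp_all
      then have "s \<in> box_coeffs v {0..d}"
        using \<alpha>n(2,3) r by (auto simp: box_coeffs_def integral_comb_def s_def)
      moreover have "s \<noteq> (\<lambda>_. 0)"
      proof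
        assume "s = (\<lambda>_. 0)"
        then have "x = 0"
          using xs by (simp only: comb) (simp add: zero_prod_def)
        then show False using x by blast
      qed
      ultimately have s_nonzero: "s j \<noteq> 0" if "j \<in> {0..d}" for j
        using R that by blast
      have "0 < r j" if "j \<in> {0..d}" for j
      proof (rule order_le_neq_trans)
        show "0 \<le> r j" "0 \<noteq> r j"
          using s_nonzero[OF that] r that unfolding s_def by auto
      qed
      then have rE: "restrict r {0..d} \<in> {0..d} \<rightarrow>\<^sub>E {0<..<1}"
        using r by (intro restrict_PiE_iff[THEN iffD2]) auto
      have xr': "x = ?comb (restrict r {0..d})"
        unfolding xr by (intro sum.cong) auto
      show "\<exists>!r. r \<in> {0..d} \<rightarrow>\<^sub>E {0<..<1} \<and> x = ?comb r"
      proof (rule ex1I[of _ "restrict r {0..d}"], rule conjI[OF rE xr'])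
        fix t assume t: "t \<in> {0..d} \<rightarrow>\<^sub>E {0<..<1} \<and> x = ?comb t"
        then have "?comb t = ?comb (restrict r {0..d})"
          using xr' by (elim conjE) (rule trans[OF sym])
        with t rE show "t = restrict r {0..d}"
          by (blast intro: PiE_ext unique)
      qed
    qed
  qed
qed

section \<open>The three conditions compared through the supports of box points\<close>

theorem theorem2p1:
  fixes v :: "nat \<Rightarrow> real ^ 'n" and P :: "(real ^ 'n) set" and d :: nat
  assumes "d = CARD('n)"
    and "\<And>j. j \<le> d \<Longrightarrow> v j \<in> int_lattice"
    and "inj_on v {0..d}"
    and "\<not> affine_dependent (v ` {0..d})"
    and "P = convex hull (v ` {0..d})"
  shows "(shifted_symmetric d (delta_vector P)
            \<longleftrightarrow> (\<forall>F. F facet_of P \<longrightarrow> normalized_volume F = 1))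
       \<and> ((\<forall>F. F facet_of P \<longrightarrow> normalized_volume F = 1)
            \<longleftrightarrow> (\<forall>x \<in> box_points d v - {0}.
                   \<exists>!r. r \<in> {0..d} \<rightarrow>\<^sub>E {0<..<1} \<and> x = (\<Sum>j = 0..d. r j *\<^sub>R (v j, 1))))"
proof -
  interpret simplex: lattice_simplex v "{0..d}"
    using assms(2-4) by unfold_locales auto
  \<comment> \<open>An index type is nonempty, so \<open>d\<close> is at least 1.\<close>
  have "2 \<le> card {0..d}"
    using assms(1) by (simp add: Suc_le_eq)
  note facets = simplex.facet_volumes_iff[OF this]
  have "shifted_symmetric d (delta_vector P) \<longleftrightarrow>
      (\<forall>r\<in>box_coeffs v {0..d}. (\<exists>k\<in>{0..d}. r k = 0) \<longrightarrow> r = (\<lambda>_. 0))"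
  proof
    assume "shifted_symmetric d (delta_vector P)"
    then show "\<forall>r\<in>box_coeffs v {0..d}. (\<exists>k\<in>{0..d}. r k = 0) \<longrightarrow> r = (\<lambda>_. 0)"
      using simplex.shifted_symmetricD assms(5) by fastforce
  next
    assume "\<forall>r\<in>box_coeffs v {0..d}. (\<exists>k\<in>{0..d}. r k = 0) \<longrightarrow> r = (\<lambda>_. 0)"
    then have "shifted_symmetric (card {0..d} - 1) (delta_vector P)"
      unfolding assms(5) by (intro simplex.shifted_symmetricI) blast
    then show "shifted_symmetric d (delta_vector P)"
      by simp
  qed
  then show ?thesis
    using box_points_iff[OF assms(2-4)] unfolding assms(5) facets by (intro conjI) (simp, rule sym)
qed

end
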